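(* Let $R,R'$ be rings, and let $K\subset R$, $K'\subset R'$ be proper subfields (not necessarily commutative, not necessarily central). Let $\phi:R\to R'$ be an antiisomorphism of rings such that $K^\phi={u'}^{-1}K'u'$ for some unit $u'\in {R'}^*$. Let $\iota:\mathbb{P}(R)\to\widehat{\mathbb{P}}(R):p\mapsto p^\perp$ be the canonical isomorphism of $\Sigma(K,R)$ onto its dual chain geometry, and let $$\widehat\phi:\widehat{\mathbb{P}}(R)\to\mathbb{P}(R'):\ (v,w)^{\mathrm T}R\mapsto R'(v^\phi,w^\phi).$$ Then the product $\iota\widehat\phi$ (first $\iota$, then $\widehat\phi$) is an isomorphism of the chain geometry $\Sigma(K,R)$ onto the chain geometry $\Sigma(K',R')$, i.e. a bijection $\mathbb{P}(R)\to\mathbb{P}(R')$ inducing a bijection $\mathfrak{C}(K,R)\to\mathfrak{C}(K',R')$.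
   Context: Rings are associative with unit element $1$, preserved by homomorphisms and inherited by subrings. A field need not be commutative. Mappings are written as exponents and products of mappings are read from left to right. An antiisomorphism is an additive bijection with $1^\phi=1'$ and $(xy)^\phi=y^\phi x^\phi$. Chain geometry. $\mathrm{GL}_2(R)$ acts from the right on the left $R$-module $R^2$ of rows. $\mathbb{P}(R)$ is the orbit of $R(1,0)$ under $\mathrm{GL}_2(R)$; points are always represented as $R(a,b)$ with $(a,b)$ the first row of some matrix in $\mathrm{GL}_2(R)$. The standard chain is $\{R(k,l)\mid (k,l)\in K^2\setminus\{(0,0)\}\}$; the set $\mathfrak{C}(K,R)$ of chains is its orbit under $\mathrm{GL}_2(R)$. $\Sigma(K,R)=(\mathbb{P}(R),\mathfrak{C}(K,R))$; similarly for $\Sigma(K',R')$. Dual chain geometry. $\mathrm{GL}_2(R)$ acts from the left on the right $R$-module $\widehat{R}^2$ of columns. $\widehat{\mathbb{P}}(R)$ is the set of all $M\cdot(1,0)^{\mathrm T}R$ with $M\in\mathrm{GL}_2(R)$; its points are always represented as $(v,w)^{\mathrm T}R$ with $(v,w)^{\mathrm T}$ the first column of some matrix in $\mathrm{GL}_2(R)$. The standard chain is $\{(k,l)^{\mathrm T}R\mid (k,l)\in K^2\setminus\{(0,0)\}\}$, and the chain set $\widehat{\mathfrak{C}}(K,R)$ is its orbit under $\mathrm{GL}_2(R)$. $\widehat\Sigma(K,R)=(\widehat{\mathbb{P}}(R),\widehat{\mathfrak{C}}(K,R))$. For $p\in\mathbb{P}(R)$, $p^\perp:=\{(x,y)^{\mathrm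 T}\in\widehat{R}^2\mid ax+by=0\text{ for all }(a,b)\in p\}$. *)

theory Defs
  imports "HOL-Analysis.Cartesian_Space"
begin

section \<open>Rings, subfields, antiisomorphisms\<close>

text \<open>
  Rings are types of class \<^class>\<open>ring_1\<close> (unital, not necessarily commutative). The law
  \<^prop>\<open>0 \<noteq> 1\<close> in that class is no restriction, since only rings with a subfield occur.
\<close>

definition skew_subfield :: "'a::ring_1 set \<Rightarrow> bool" where
  "skew_subfield K \<longleftrightarrow> 1 \<in> K \<and> (\<forall>x\<in>K. \<forall>y\<in>K. x - y \<in> K \<and> x * y \<in> K)
    \<and> (\<forall>x\<in>K. x \<noteq> 0 \<longrightarrow> (\<exists>y\<in>K. x * y = 1 \<and> y * x = 1))"

definition antiisomorphism :: "('a::ring_1 \<Rightarrow> 'b::ring_1) \<Rightarrow> bool" where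
  "antiisomorphism \<phi> \<longleftrightarrow> bij \<phi> \<and> (\<forall>x y. \<phi> (x + y) = \<phi> x + \<phi> y) \<and> \<phi> 1 = 1
    \<and> (\<forall>x y. \<phi> (x * y) = \<phi> y * \<phi> x)"


section \<open>The projective line and the chain geometry\<close>

text \<open>
  Rows and columns are both elements of \<open>'a ^ 2\<close>. As rows they form a left module under
  \<open>*s\<close>, on which matrices act from the right by \<open>v*\<close>; as columns they form a right module,
  on which matrices act from the left by \<open>*v\<close>. A point is a cyclic submodule, given as a set
  of vectors.
\<close>

definition left_span :: "'a::ring_1 ^ 2 \<Rightarrow> ('a ^ 2) set" where
  "left_span x = {r *s x | r. True}"

definition right_span :: "'a::ring_1 ^ 2 \<Rightarrow> ('a ^ 2) set" where
  "right_span x = {(\<chi> i. x $ i * r) | r. True}"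

definition GL2 :: "('a::ring_1 ^ 2 ^ 2) set" where
  "GL2 = {M. invertible M}"

definition proj_line :: "('a::ring_1 ^ 2) set set" where
  "proj_line = {(\<lambda>x. x v* M) ` left_span (vector [1, 0]) | M. M \<in> GL2}"

definition standard_chain :: "'a::ring_1 set \<Rightarrow> ('a ^ 2) set set" where
  "standard_chain K = {left_span (vector [k, l]) | k l. k \<in> K \<and> l \<in> K \<and> (k, l) \<noteq> (0, 0)}"

definition chain_set :: "'a::ring_1 set \<Rightarrow> ('a ^ 2) set set set" where
  "chain_set K = {(\<lambda>p. (\<lambda>x. x v* M) ` p) ` standard_chain K | M. M \<in> GL2}"

definition chain_geometry :: "'a::ring_1 set \<Rightarrow> ('a ^ 2) set set \<times> ('a ^ 2) set set set" where
  "chain_geometry K = (proj_line, chain_set K)"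

definition dual_proj_line :: "('a::ring_1 ^ 2) set set" where
  "dual_proj_line = {(\<lambda>x. M *v x) ` right_span (vector [1, 0]) | M. M \<in> GL2}"

definition dual_standard_chain :: "'a::ring_1 set \<Rightarrow> ('a ^ 2) set set" where
  "dual_standard_chain K =
    {right_span (vector [k, l]) | k l. k \<in> K \<and> l \<in> K \<and> (k, l) \<noteq> (0, 0)}"

definition dual_chain_set :: "'a::ring_1 set \<Rightarrow> ('a ^ 2) set set set" where
  "dual_chain_set K = {(\<lambda>p. (\<lambda>x. M *v x) ` p) ` dual_standard_chain K | M. M \<in> GL2}"

definition dual_chain_geometry :: "'a::ring_1 set \<Rightarrow> ('a ^ 2) set set \<times> ('a ^ 2) set set set" where
  "dual_chain_geometry K = (dual_proj_line, dual_chain_set K)"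

definition chain_isomorphism ::
    "('p \<Rightarrow> 'q) \<Rightarrow> 'p set \<times> 'p set set \<Rightarrow> 'q set \<times> 'q set set \<Rightarrow> bool" where
  "chain_isomorphism f \<Sigma> \<Sigma>' \<longleftrightarrow>
    bij_betw f (fst \<Sigma>) (fst \<Sigma>') \<and> bij_betw (\<lambda>C. f ` C) (snd \<Sigma>) (snd \<Sigma>')"


section \<open>The two maps\<close>

definition perp :: "('a::ring_1 ^ 2) set \<Rightarrow> ('a ^ 2) set" where
  "perp p = {x. \<forall>y\<in>p. y $ 1 * x $ 1 + y $ 2 * x $ 2 = 0}"

text \<open>
  The map \<open>(v, w)\<^sup>T R \<mapsto> R' (\<phi> v, \<phi> w)\<close>, where \<open>(v, w)\<^sup>T\<close> ranges over the admissible
  representatives, i.e. first columns of invertible matrices. That the value does not depend on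
  the representative is \<open>hat_map_eq\<close> below.
\<close>

definition hat_map :: "('a::ring_1 \<Rightarrow> 'b::ring_1) \<Rightarrow> ('a ^ 2) set \<Rightarrow> ('b ^ 2) set" where
  "hat_map \<phi> q = (THE p. \<exists>v w. (\<exists>M\<in>GL2. vector [v, w] = column 1 M)
     \<and> q = right_span (vector [v, w]) \<and> p = left_span (vector [\<phi> v, \<phi> w]))"


section \<open>Well-definedness of the two maps\<close>

text \<open>
  The dual chain geometry enters the definition of \<open>hat_map\<close> only through the admissible
  representatives of its points; \<open>perp_chain_isomorphism\<close> below shows that \<^const>\<open>perp\<close>
  is indeed an isomorphism of the chain geometry onto the dual one.
\<close>

lemma left_span_antiisomorphism:
  fixes \<phi> :: "'a::ring_1 \<Rightarrow> 'b::ring_1"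
  assumes "antiisomorphism \<phi>"
  shows "left_span (vector [\<phi> v, \<phi> w]) =
    (\<lambda>x. \<chi> i. \<phi> (x $ i)) ` right_span (vector [v, w])"
proof -
  have *: "(\<chi> i. \<phi> (vector [v, w] $ i * r)) = (\<phi> r *s vector [\<phi> v, \<phi> w] :: 'b ^ 2)" for r
    using assms
    by (simp add: antiisomorphism_def vec_eq_iff forall_2 vector_scalar_mult_def)
  have "surj \<phi>" using assms by (simp add: antiisomorphism_def bij_is_surj)
  then have "range (\<lambda>r. \<phi> r *s vector [\<phi> v, \<phi> w] :: 'b ^ 2)
      = range (\<lambda>r. r *s vector [\<phi> v, \<phi> w])"
    by (simp flip: image_image[of "\<lambda>r. r *s vector [\<phi> v, \<phi> w]" \<phi>])
  then show ?thesis
    by (simp add: left_span_def right_span_def full_SetCompr_eq image_image *)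
qed

lemma hat_map_eq:
  assumes "antiisomorphism \<phi>" and "M \<in> GL2" and "vector [v, w] = column 1 M"
  shows "hat_map \<phi> (right_span (vector [v, w])) = left_span (vector [\<phi> v, \<phi> w])"
  unfolding hat_map_def
proof (rule the_equality)
  show "\<exists>v' w'. (\<exists>M\<in>GL2. vector [v', w'] = column 1 M)
      \<and> right_span (vector [v, w]) = right_span (vector [v', w'])
      \<and> left_span (vector [\<phi> v, \<phi> w]) = left_span (vector [\<phi> v', \<phi> w'])"
    by (intro exI conjI bexI[of _ M]) (rule assms refl)+
next
  fix p
  assume "\<exists>v' w'. (\<exists>M\<in>GL2. vector [v', w'] = column 1 M)
      \<and> right_span (vector [v, w]) = right_span (vector [v', w'])
      \<and> p = left_span (vector [\<phi> v', \<phi> w'])"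
  then obtain v' w' where "right_span (vector [v, w]) = right_span (vector [v', w'])"
    and "p = left_span (vector [\<phi> v', \<phi> w'])"
    by (elim exE conjE)
  then show "p = left_span (vector [\<phi> v, \<phi> w])"
    by (simp only: left_span_antiisomorphism[OF assms(1)])
qed

lemma vector_matrix_assoc: "(x v* A) v* (B :: 'a::ring_1 ^ 2 ^ 2) = x v* ((A :: 'a ^ 2 ^ 2) ** B)"
  by (simp add: vec_eq_iff forall_2 vector_matrix_mult_def matrix_matrix_mult_def sum_2
      algebra_simps)

lemma vector_matrix_one: "x v* (mat 1 :: 'a::ring_1 ^ 2 ^ 2) = x"
  by (simp add: vec_eq_iff forall_2 vector_matrix_mult_def mat_def sum_2)

lemma matrix_vector_assoc: "(A :: 'a::ring_1 ^ 2 ^ 2) *v ((B :: 'a ^ 2 ^ 2) *v x) = (A ** B) *v x"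
  by (simp add: vec_eq_iff forall_2 matrix_vector_mult_def matrix_matrix_mult_def sum_2
      algebra_simps)

lemma matrix_vector_one: "(mat 1 :: 'a::ring_1 ^ 2 ^ 2) *v x = x"
  by (simp add: vec_eq_iff forall_2 matrix_vector_mult_def mat_def sum_2)

lemma GL2E:
  assumes "M \<in> GL2"
  obtains N where "N \<in> GL2" "M ** N = mat 1" "N ** M = mat 1"
  using assms unfolding GL2_def invertible_def by blast

lemma GL2I: "M ** N = mat 1 \<Longrightarrow> N ** M = mat 1 \<Longrightarrow> M \<in> GL2"
  unfolding GL2_def invertible_def by blast

lemma proj_lineI: "M \<in> GL2 \<Longrightarrow> (\<lambda>x. x v* M) ` left_span (vector [1, 0]) \<in> proj_line"
  unfolding proj_line_def by (rule CollectI, rule exI, rule conjI, rule refl)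

lemma dual_proj_lineI: "M \<in> GL2 \<Longrightarrow> (\<lambda>x. M *v x) ` right_span (vector [1, 0]) \<in> dual_proj_line"
  unfolding dual_proj_line_def by (rule CollectI, rule exI, rule conjI, rule refl)

lemma chain_setI: "M \<in> GL2 \<Longrightarrow> (\<lambda>p. (\<lambda>x. x v* M) ` p) ` standard_chain K \<in> chain_set K"
  unfolding chain_set_def by (rule CollectI, rule exI, rule conjI, rule refl)

lemma dual_chain_setI: "M \<in> GL2 \<Longrightarrow> (\<lambda>p. (\<lambda>x. M *v x) ` p) ` dual_standard_chain K \<in> dual_chain_set K"
  unfolding dual_chain_set_def by (rule CollectI, rule exI, rule conjI, rule refl)

lemma GL2_mult:
  assumes "A \<in> GL2" and "B \<in> GL2"
  shows "A ** B \<in> GL2"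
proof -
  obtain A' where A': "A ** A' = mat 1" "A' ** A = mat 1" using assms(1) by (metis GL2E)
  obtain B' where B': "B ** B' = mat 1" "B' ** B = mat 1" using assms(2) by (metis GL2E)
  have "A ** B ** (B' ** A') = A ** (B ** B') ** A'" "B' ** A' ** (A ** B) = B' ** (A' ** A) ** B"
    by (simp_all only: matrix_mul_assoc)
  then show ?thesis by (intro GL2I[of _ "B' ** A'"]) (simp_all add: A' B')
qed

definition left_perp :: "('a::ring_1 ^ 2) set \<Rightarrow> ('a ^ 2) set" where
  "left_perp q = {y. \<forall>x\<in>q. y $ 1 * x $ 1 + y $ 2 * x $ 2 = 0}"

lemma pairing:
  "(y v* (M :: 'a::ring_1 ^ 2 ^ 2)) $ 1 * x $ 1 + (y v* M) $ 2 * x $ 2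
    = y $ 1 * (M *v x) $ 1 + y $ 2 * (M *v x) $ 2"
  by (simp add: vector_matrix_mult_def matrix_vector_mult_def sum_2 algebra_simps)

lemma perp_act:
  assumes "M ** N = mat 1" and "N ** M = mat 1"
  shows "perp ((\<lambda>x. x v* M) ` p) = (\<lambda>x. N *v x) ` perp p"
proof (intro set_eqI iffI)
  fix x assume "x \<in> perp ((\<lambda>x. x v* M) ` p)"
  then have "M *v x \<in> perp p" by (auto simp: perp_def pairing)
  moreover have "x = N *v (M *v x)" by (simp add: matrix_vector_assoc assms matrix_vector_one)
  ultimately show "x \<in> (\<lambda>x. N *v x) ` perp p" by blast
next
  fix x assume "x \<in> (\<lambda>x. N *v x) ` perp p"
  then show "x \<in> perp ((\<lambda>x. x v* M) ` p)"
    by (auto simp: perp_def pairing matrix_vector_assoc assms matrix_vector_one)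
qed

lemma left_perp_act:
  assumes "M ** N = mat 1" and "N ** M = mat 1"
  shows "left_perp ((\<lambda>x. N *v x) ` q) = (\<lambda>x. x v* M) ` left_perp q"
proof (intro set_eqI iffI)
  fix y assume "y \<in> left_perp ((\<lambda>x. N *v x) ` q)"
  then have "y v* N \<in> left_perp q" by (auto simp: left_perp_def pairing)
  moreover have "y = (y v* N) v* M" by (simp add: vector_matrix_assoc assms vector_matrix_one)
  ultimately show "y \<in> (\<lambda>x. x v* M) ` left_perp q" by blast
next
  fix y assume "y \<in> (\<lambda>x. x v* M) ` left_perp q"
  then show "y \<in> left_perp ((\<lambda>x. N *v x) ` q)"
    by (auto simp: left_perp_def pairing matrix_vector_assoc assms matrix_vector_one)
qed

lemma mem_left_span: "y \<in> left_span x \<longleftrightarrow> (\<exists>r. y $ 1 = r * x $ 1 \<and> y $ 2 = r * x $ 2)"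
  by (auto simp: left_span_def vec_eq_iff forall_2 vector_scalar_mult_def)

lemma mem_right_span: "y \<in> right_span x \<longleftrightarrow> (\<exists>r. y $ 1 = x $ 1 * r \<and> y $ 2 = x $ 2 * r)"
  by (auto simp: right_span_def vec_eq_iff forall_2)

lemma perp_base: "perp (left_span (vector [1, 0])) = right_span (vector [0, 1 :: 'a::ring_1])"
proof -
  have "x \<in> perp (left_span (vector [1, 0 :: 'a])) \<longleftrightarrow> x $ 1 = 0" for x
  proof
    assume "x \<in> perp (left_span (vector [1, 0]))"
    moreover have "vector [1, 0] \<in> left_span (vector [1, 0 :: 'a])"
      by (auto simp: mem_left_span intro: exI[of _ 1])
    ultimately show "x $ 1 = 0" by (auto simp: perp_def)
  qed (auto simp: perp_def mem_left_span)
  then show ?thesis by (simp add: set_eq_iff mem_right_span)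
qed

lemma left_perp_base: "left_perp (right_span (vector [0, 1])) = left_span (vector [1, 0 :: 'a::ring_1])"
proof -
  have "y \<in> left_perp (right_span (vector [0, 1 :: 'a])) \<longleftrightarrow> y $ 2 = 0" for y
  proof
    assume "y \<in> left_perp (right_span (vector [0, 1]))"
    moreover have "vector [0, 1] \<in> right_span (vector [0, 1 :: 'a])"
      by (auto simp: mem_right_span intro: exI[of _ 1])
    ultimately show "y $ 2 = 0" by (auto simp: left_perp_def)
  qed (auto simp: left_perp_def mem_right_span)
  then show ?thesis by (simp add: set_eq_iff mem_left_span)
qed

definition swap_matrix :: "'a::ring_1 ^ 2 ^ 2" where
  "swap_matrix = vector [vector [0, 1], vector [1, 0]]"

lemma swap_swap: "swap_matrix ** swap_matrix = (mat 1 :: 'a::ring_1 ^ 2 ^ 2)"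
  by (simp add: vec_eq_iff forall_2 swap_matrix_def matrix_matrix_mult_def sum_2 mat_def)

lemma swap_GL2: "(swap_matrix :: 'a::ring_1 ^ 2 ^ 2) \<in> GL2"
  by (rule GL2I[OF swap_swap swap_swap])

lemma swap_base: "(\<lambda>x. swap_matrix *v x) ` right_span (vector [a, b]) = right_span (vector [b, a :: 'a::ring_1])"
proof -
  have *: "swap_matrix *v (\<chi> i. vector [a, b] $ i * r) = (\<chi> i. vector [b, a] $ i * r)" for r :: 'a
    by (simp add: vec_eq_iff forall_2 swap_matrix_def matrix_vector_mult_def sum_2)
  show ?thesis by (simp add: right_span_def full_SetCompr_eq image_image *)
qed

lemma left_perp_perp: "p \<in> proj_line \<Longrightarrow> left_perp (perp p) = p"
proof -
  assume "p \<in> proj_line"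
  then obtain M where M: "M \<in> GL2" "p = (\<lambda>x. x v* M) ` left_span (vector [1, 0])"
    by (auto simp: proj_line_def)
  obtain N where N: "M ** N = mat 1" "N ** M = mat 1" using M(1) by (metis GL2E)
  show ?thesis
    by (simp only: M(2) perp_act[OF N] perp_base left_perp_act[OF N] left_perp_base)
qed

lemma perp_proj_line: "perp ` proj_line = (dual_proj_line :: ('a::ring_1 ^ 2) set set)"
proof (intro set_eqI iffI)
  fix q :: "('a ^ 2) set" assume "q \<in> perp ` proj_line"
  then obtain M where M: "M \<in> GL2" "q = perp ((\<lambda>x. x v* M) ` left_span (vector [1, 0]))"
    by (auto simp: proj_line_def)
  obtain N where N: "N \<in> GL2" "M ** N = mat 1" "N ** M = mat 1" using M(1) by (rule GL2E)
  have "q = (\<lambda>x. N *v x) ` (\<lambda>x. swap_matrix *v x) ` right_span (vector [1, 0])"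
    by (simp add: M(2) perp_act[OF N(2,3)] perp_base swap_base)
  also have "\<dots> = (\<lambda>x. (N ** swap_matrix) *v x) ` right_span (vector [1, 0])"
    by (simp add: image_image matrix_vector_assoc)
  finally show "q \<in> dual_proj_line" by (simp only: dual_proj_lineI[OF GL2_mult[OF N(1) swap_GL2]])
next
  fix q :: "('a ^ 2) set" assume "q \<in> dual_proj_line"
  then obtain M where M: "M \<in> GL2" "q = (\<lambda>x. M *v x) ` right_span (vector [1, 0])"
    by (auto simp: dual_proj_line_def)
  have "M ** swap_matrix \<in> GL2" by (rule GL2_mult[OF M(1) swap_GL2])
  then obtain N where N: "N \<in> GL2" "(M ** swap_matrix) ** N = mat 1" "N ** (M ** swap_matrix) = mat 1"
    by (rule GL2E)
  have "perp ((\<lambda>x. x v* N) ` left_span (vector [1, 0]))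
      = (\<lambda>x. M *v x) ` (\<lambda>x. swap_matrix *v x) ` right_span (vector [0, 1])"
    by (simp add: perp_act[OF N(3,2)] perp_base image_image matrix_vector_assoc)
  also have "\<dots> = q" by (simp add: swap_base M(2))
  finally show "q \<in> perp ` proj_line" using proj_lineI[OF N(1)] by (metis imageI)
qed

lemma left_span_unit:
  assumes "(s :: 'a::ring_1) * t = 1" and "t * s = 1"
  shows "left_span (vector [s * a, s * b]) = left_span (vector [a, b])"
proof (intro set_eqI iffI)
  fix x assume "x \<in> left_span (vector [s * a, s * b])"
  then obtain r where "x $ 1 = r * (s * a)" "x $ 2 = r * (s * b)" by (auto simp: mem_left_span)
  then show "x \<in> left_span (vector [a, b])"
    by (auto simp: mem_left_span mult.assoc intro!: exI[of _ "r * s"])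
next
  have st: "t * (s * c) = c" for c by (simp add: assms flip: mult.assoc)
  fix x assume "x \<in> left_span (vector [a, b])"
  then obtain r where "x $ 1 = r * a" "x $ 2 = r * b" by (auto simp: mem_left_span)
  then show "x \<in> left_span (vector [s * a, s * b])"
    by (auto simp: mem_left_span mult.assoc st intro!: exI[of _ "r * t"])
qed

lemma right_span_unit:
  assumes "(s :: 'a::ring_1) * t = 1" and "t * s = 1"
  shows "right_span (vector [a * s, b * s]) = right_span (vector [a, b])"
proof (intro set_eqI iffI)
  fix x assume "x \<in> right_span (vector [a * s, b * s])"
  then obtain r where "x $ 1 = a * s * r" "x $ 2 = b * s * r" by (auto simp: mem_right_span)
  then show "x \<in> right_span (vector [a, b])"
    by (auto simp: mem_right_span mult.assoc intro!: exI[of _ "s * r"])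
next
  have st: "s * (t * c) = c" for c by (simp add: assms flip: mult.assoc)
  fix x assume "x \<in> right_span (vector [a, b])"
  then obtain r where "x $ 1 = a * r" "x $ 2 = b * r" by (auto simp: mem_right_span)
  then show "x \<in> right_span (vector [a * s, b * s])"
    by (auto simp: mem_right_span mult.assoc st intro!: exI[of _ "t * r"])
qed

lemma perp_1: "perp (left_span (vector [1, a])) = right_span (vector [- a, 1 :: 'a::ring_1])"
proof -
  have "x \<in> perp (left_span (vector [1, a])) \<longleftrightarrow> x $ 1 = - (a * x $ 2)" for x
  proof
    assume "x \<in> perp (left_span (vector [1, a]))"
    moreover have "vector [1, a] \<in> left_span (vector [1, a])"
      by (auto simp: mem_left_span intro: exI[of _ 1])
    ultimately have "x $ 1 + a * x $ 2 = 0" by (auto simp: perp_def)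
    then show "x $ 1 = - (a * x $ 2)" by (rule eq_neg_iff_add_eq_0[THEN iffD2])
  qed (auto simp: perp_def mem_left_span mult.assoc)
  then show ?thesis by (simp add: set_eq_iff mem_right_span)
qed

lemma perp_0: "perp (left_span (vector [0, 1])) = right_span (vector [1, 0 :: 'a::ring_1])"
proof -
  have "x \<in> perp (left_span (vector [0, 1 :: 'a])) \<longleftrightarrow> x $ 2 = 0" for x
  proof
    assume "x \<in> perp (left_span (vector [0, 1]))"
    moreover have "vector [0, 1] \<in> left_span (vector [0, 1 :: 'a])"
      by (auto simp: mem_left_span intro: exI[of _ 1])
    ultimately show "x $ 2 = 0" by (auto simp: perp_def)
  qed (auto simp: perp_def mem_left_span)
  then show ?thesis by (simp add: set_eq_iff mem_right_span)
qed

lemma subfield_closed: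
  assumes "skew_subfield K"
  shows "0 \<in> K" "1 \<in> K" "x \<in> K \<Longrightarrow> - x \<in> K" "x \<in> K \<Longrightarrow> y \<in> K \<Longrightarrow> x * y \<in> K"
proof -
  show 0: "0 \<in> K" using assms unfolding skew_subfield_def by (metis diff_self)
  show "1 \<in> K" "x \<in> K \<Longrightarrow> y \<in> K \<Longrightarrow> x * y \<in> K" using assms by (auto simp: skew_subfield_def)
  show "x \<in> K \<Longrightarrow> - x \<in> K" using assms 0 unfolding skew_subfield_def by (metis diff_0)
qed

lemma subfield_inverse:
  assumes "skew_subfield K" "x \<in> K" "x \<noteq> 0"
  obtains y where "y \<in> K" "x * y = 1" "y * x = 1"
  using assms unfolding skew_subfield_def by blast

lemma standard_chain_alt:
  assumes "skew_subfield K"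
  shows "standard_chain K = insert (left_span (vector [0, 1])) {left_span (vector [1, a]) | a. a \<in> K}"
    (is "_ = ?R")
proof (intro equalityI subsetI)
  fix p assume "p \<in> standard_chain K"
  then obtain k l where kl: "k \<in> K" "l \<in> K" "(k, l) \<noteq> (0, 0)" "p = left_span (vector [k, l])"
    by (auto simp: standard_chain_def)
  show "p \<in> ?R"
  proof (cases "k = 0")
    case True
    then have "l \<noteq> 0" using kl by simp
    then obtain y where "y \<in> K" and y: "l * y = 1" "y * l = 1" by (rule subfield_inverse[OF assms kl(2)])
    from left_span_unit[OF y, of 0 1] show ?thesis using kl True by simp
  next
    case False
    then obtain y where y: "y \<in> K" "k * y = 1" "y * k = 1" by (rule subfield_inverse[OF assms kl(1)])
    have p: "p = left_span (vector [1, y * l])"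
      using left_span_unit[OF y(2,3), of 1 "y * l"] kl y by (simp flip: mult.assoc)
    show ?thesis
      by (rule insertI2, rule CollectI, rule exI, rule conjI, rule p, rule subfield_closed(4)[OF assms y(1) kl(2)])
  qed
next
  fix p assume "p \<in> ?R"
  then consider (inf) "p = left_span (vector [0, 1])"
    | (fin) a where "a \<in> K" "p = left_span (vector [1, a])"
    by auto
  then show "p \<in> standard_chain K"
  proof cases
    case inf
    show ?thesis
      unfolding standard_chain_def
      by (intro CollectI exI conjI, rule inf) (use subfield_closed(1,2)[OF assms] in auto)
  next
    case fin
    show ?thesis
      unfolding standard_chain_def
      by (intro CollectI exI conjI, rule fin(2)) (use fin(1) subfield_closed(1,2)[OF assms] in auto)
  qed
qed

lemma dual_standard_chain_alt:
  assumes "skew_subfield K"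
  shows "dual_standard_chain K =
    insert (right_span (vector [1, 0])) {right_span (vector [a, 1]) | a. a \<in> K}"
    (is "_ = ?R")
proof (intro equalityI subsetI)
  fix p assume "p \<in> dual_standard_chain K"
  then obtain k l where kl: "k \<in> K" "l \<in> K" "(k, l) \<noteq> (0, 0)" "p = right_span (vector [k, l])"
    by (auto simp: dual_standard_chain_def)
  show "p \<in> ?R"
  proof (cases "l = 0")
    case True
    then have "k \<noteq> 0" using kl by simp
    then obtain y where "y \<in> K" and y: "k * y = 1" "y * k = 1" by (rule subfield_inverse[OF assms kl(1)])
    from right_span_unit[OF y, of 1 0] show ?thesis using kl True by simp
  next
    case False
    then obtain y where y: "y \<in> K" "l * y = 1" "y * l = 1" by (rule subfield_inverse[OF assms kl(2)])
    have p: "p = right_span (vector [k * y, 1])"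
      using right_span_unit[OF y(2,3), of "k * y" 1] kl y by (simp add: mult.assoc)
    show ?thesis
      by (rule insertI2, rule CollectI, rule exI, rule conjI, rule p, rule subfield_closed(4)[OF assms kl(1) y(1)])
  qed
next
  fix p assume "p \<in> ?R"
  then consider (inf) "p = right_span (vector [1, 0])"
    | (fin) a where "a \<in> K" "p = right_span (vector [a, 1])"
    by auto
  then show "p \<in> dual_standard_chain K"
  proof cases
    case inf
    show ?thesis
      unfolding dual_standard_chain_def
      by (intro CollectI exI conjI, rule inf) (use subfield_closed(1,2)[OF assms] in auto)
  next
    case fin
    show ?thesis
      unfolding dual_standard_chain_def
      by (intro CollectI exI conjI, rule fin(2)) (use fin(1) subfield_closed(1,2)[OF assms] in auto)
  qed
qed

lemma perp_standard_chain:
  assumes "skew_subfield K"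
  shows "perp ` standard_chain K = dual_standard_chain K"
proof -
  have "perp ` {left_span (vector [1, a]) | a. a \<in> K} = {right_span (vector [a, 1]) | a. a \<in> K}"
  proof (intro equalityI subsetI)
    fix q assume "q \<in> perp ` {left_span (vector [1, a]) | a. a \<in> K}"
    then obtain a where a: "a \<in> K" "q = perp (left_span (vector [1, a]))" by auto
    from a(2) have "q = right_span (vector [- a, 1])" by (simp only: perp_1)
    then show "q \<in> {right_span (vector [a, 1]) | a. a \<in> K}"
      using subfield_closed(3)[OF assms a(1)] by (intro CollectI exI[of _ "- a"] conjI)
  next
    fix q assume "q \<in> {right_span (vector [a, 1]) | a. a \<in> K}"
    then obtain a where a: "a \<in> K" "q = right_span (vector [a, 1])" by auto
    then have q: "q = perp (left_span (vector [1, - a]))" by (simp only: perp_1 minus_minus)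
    have "left_span (vector [1, - a]) \<in> {left_span (vector [1, a]) | a. a \<in> K}"
      by (rule CollectI, rule exI, rule conjI, rule refl) (rule subfield_closed(3)[OF assms a(1)])
    with q show "q \<in> perp ` {left_span (vector [1, a]) | a. a \<in> K}" by (rule image_eqI)
  qed
  then show ?thesis
    by (simp add: standard_chain_alt[OF assms] dual_standard_chain_alt[OF assms] perp_0)
qed

lemma first_row_GL2:
  fixes M :: "'a::ring_1 ^ 2 ^ 2"
  assumes "M \<in> GL2"
  shows "left_span (M $ 1) \<in> proj_line"
proof -
  have *: "(r *s vector [1, 0]) v* M = r *s M $ 1" for r :: 'a
    by (simp add: vec_eq_iff forall_2 vector_matrix_mult_def vector_scalar_mult_def sum_2)
  have "left_span (M $ 1) = (\<lambda>x. x v* M) ` left_span (vector [1, 0])"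
    by (simp add: left_span_def full_SetCompr_eq image_image *)
  then show ?thesis by (simp only: proj_lineI[OF assms])
qed

lemma standard_chain_proj_line:
  assumes "skew_subfield (K :: 'a::ring_1 set)"
  shows "standard_chain K \<subseteq> proj_line"
proof -
  have "left_span (vector [1, a]) \<in> proj_line" for a :: 'a
  proof -
    have "(vector [vector [1, a], vector [0, 1]] :: 'a ^ 2 ^ 2) \<in> GL2"
      by (rule GL2I[of _ "vector [vector [1, - a], vector [0, 1]]"])
        (simp_all add: vec_eq_iff forall_2 matrix_matrix_mult_def sum_2 mat_def)
    from first_row_GL2[OF this] show ?thesis by simp
  qed
  moreover have "left_span (vector [0, 1 :: 'a]) \<in> proj_line"
    using first_row_GL2[OF swap_GL2] by (simp add: swap_matrix_def)
  ultimately show ?thesis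
    unfolding standard_chain_alt[OF assms] by (intro subsetI) (elim insertE CollectE exE conjE, simp_all)
qed

lemma act_proj_line:
  assumes "M \<in> GL2" and "p \<in> proj_line"
  shows "(\<lambda>x. x v* M) ` p \<in> proj_line"
proof -
  obtain A where A: "A \<in> GL2" "p = (\<lambda>x. x v* A) ` left_span (vector [1, 0])"
    using assms(2) by (auto simp: proj_line_def)
  have "(\<lambda>x. x v* M) ` p = (\<lambda>x. x v* (A ** M)) ` left_span (vector [1, 0])"
    by (simp add: A(2) image_image vector_matrix_assoc)
  then show ?thesis by (simp only: proj_lineI[OF GL2_mult[OF A(1) assms(1)]])
qed

lemma chains_proj_line:
  assumes "skew_subfield K" and "C \<in> chain_set K"
  shows "C \<subseteq> proj_line"
  using assms(2) standard_chain_proj_line[OF assms(1)] by (auto simp: chain_set_def intro!: act_proj_line)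

lemma perp_chain_act:
  assumes "skew_subfield K" and "M ** N = mat 1" and "N ** M = mat 1"
  shows "perp ` (\<lambda>p. (\<lambda>x. x v* M) ` p) ` standard_chain K
    = (\<lambda>p. (\<lambda>x. N *v x) ` p) ` dual_standard_chain K"
  by (simp add: image_image perp_act[OF assms(2,3)] flip: perp_standard_chain[OF assms(1)])

theorem perp_chain_isomorphism:
  assumes "skew_subfield K"
  shows "chain_isomorphism perp (chain_geometry K) (dual_chain_geometry K)"
proof -
  have inj: "inj_on perp proj_line" by (metis inj_onI left_perp_perp)
  have "inj_on (\<lambda>C. perp ` C) (chain_set K)"
    by (rule inj_onI) (metis inj chains_proj_line[OF assms] inj_on_image_eq_iff)
  moreover have "(\<lambda>C. perp ` C) ` chain_set K = dual_chain_set K"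
  proof (intro equalityI subsetI)
    fix D assume "D \<in> (\<lambda>C. perp ` C) ` chain_set K"
    then obtain M where M: "M \<in> GL2"
      "D = perp ` (\<lambda>p. (\<lambda>x. x v* M) ` p) ` standard_chain K"
      by (auto simp: chain_set_def)
    obtain N where N: "N \<in> GL2" "M ** N = mat 1" "N ** M = mat 1" using M(1) by (rule GL2E)
    show "D \<in> dual_chain_set K"
      unfolding M(2) perp_chain_act[OF assms N(2,3)] by (rule dual_chain_setI[OF N(1)])
  next
    fix D assume "D \<in> dual_chain_set K"
    then obtain N where N: "N \<in> GL2" "D = (\<lambda>p. (\<lambda>x. N *v x) ` p) ` dual_standard_chain K"
      by (auto simp: dual_chain_set_def)
    obtain M where M: "M \<in> GL2" "N ** M = mat 1" "M ** N = mat 1" using N(1) by (rule GL2E)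
    show "D \<in> (\<lambda>C. perp ` C) ` chain_set K"
      unfolding N(2) perp_chain_act[OF assms M(3,2), symmetric] by (rule imageI[OF chain_setI[OF M(1)]])
  qed
  ultimately show ?thesis
    by (simp add: chain_isomorphism_def chain_geometry_def dual_chain_geometry_def bij_betw_def
        inj perp_proj_line)
qed

end

theory Submission
  imports Defs
begin

text \<open>
  On points of the dual projective line, \<open>hat_map \<phi>\<close> is just the elementwise image under the
  coordinatewise map \<open>x \<mapsto> (\<phi> x\<^sub>1, \<phi> x\<^sub>2)\<close>. That map turns the left action of a matrix \<open>M\<close> into the
  right action of the transpose of \<open>\<phi>(M)\<close>, and \<open>M \<mapsto> \<phi>(M)\<^sup>T\<close> is an antiisomorphism of matrix rings,
  so it maps \<open>GL\<^sub>2(R)\<close> onto \<open>GL\<^sub>2(R')\<close>. The dual standard chain goes to the standard chain of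
  \<open>u'\<inverse> K' u'\<close>, which is the image of the standard chain of \<open>K'\<close> under \<open>diag(u', u')\<close>.
\<close>

section \<open>Coordinatewise transport along an antiisomorphism\<close>

definition vec_map :: "('a \<Rightarrow> 'b) \<Rightarrow> 'a ^ 2 \<Rightarrow> 'b ^ 2" where
  "vec_map f x = (\<chi> i. f (x $ i))"

definition transpose_map :: "('a \<Rightarrow> 'b) \<Rightarrow> 'a ^ 2 ^ 2 \<Rightarrow> 'b ^ 2 ^ 2" where
  "transpose_map f M = (\<chi> i j. f (M $ j $ i))"

lemma antiisomorphism_zero:
  assumes "antiisomorphism \<phi>"
  shows "\<phi> 0 = 0"
proof -
  have "\<phi> (0 + 0) = \<phi> 0 + \<phi> 0" using assms unfolding antiisomorphism_def by blast
  then show ?thesis by simp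
qed

lemma inj_vec_map: "inj f \<Longrightarrow> inj (vec_map f)"
  by (auto simp: inj_def vec_map_def vec_eq_iff)

lemma vec_map_right_span:
  "antiisomorphism \<phi> \<Longrightarrow>
    vec_map \<phi> ` right_span (vector [v, w]) = left_span (vector [\<phi> v, \<phi> w])"
  by (simp add: left_span_antiisomorphism vec_map_def[abs_def])

text \<open>Each product of a matrix entry and a coordinate is reversed by \<open>\<phi>\<close>,
  which is exactly the order of factors in a row times the index-swapped matrix.\<close>

lemma vec_map_mult:
  "antiisomorphism \<phi> \<Longrightarrow> vec_map \<phi> (M *v x) = vec_map \<phi> x v* transpose_map \<phi> M"
  by (simp add: antiisomorphism_def vec_eq_iff forall_2 vec_map_def transpose_map_def
      matrix_vector_mult_def vector_matrix_mult_def sum_2)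

text \<open>Transposition alone reverses matrix products only over commutative rings; here
  \<open>\<phi>\<close> also reverses the products of entries, so the sums agree.\<close>

lemma transpose_map_mult:
  "antiisomorphism \<phi> \<Longrightarrow>
    transpose_map \<phi> (A ** B) = transpose_map \<phi> B ** transpose_map \<phi> A"
  by (simp add: antiisomorphism_def vec_eq_iff forall_2 transpose_map_def
      matrix_matrix_mult_def sum_2)

lemma transpose_map_one: "antiisomorphism \<phi> \<Longrightarrow> transpose_map \<phi> (mat 1) = mat 1"
  using antiisomorphism_zero[of \<phi>]
  by (simp add: antiisomorphism_def vec_eq_iff forall_2 transpose_map_def mat_def)

lemma transpose_map_GL2:
  assumes "antiisomorphism \<phi>" "M \<in> GL2"
  shows "transpose_map \<phi> M \<in> GL2"
proof -
  obtain N where "M ** N = mat 1" "N ** M = mat 1" using assms(2) by (rule GL2E)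
  then show ?thesis
    using transpose_map_mult[OF assms(1)] transpose_map_one[OF assms(1)] by (metis GL2I)
qed

lemma antiisomorphism_inv:
  assumes "antiisomorphism \<phi>"
  shows "antiisomorphism (inv \<phi>)"
proof -
  have b: "bij \<phi>" and h: "\<phi> (x + y) = \<phi> x + \<phi> y" "\<phi> 1 = 1" "\<phi> (x * y) = \<phi> y * \<phi> x" for x y
    using assms by (auto simp: antiisomorphism_def)
  \<comment> \<open>A value of \<open>inv \<phi>\<close> is found by exhibiting a preimage, so each
    law for \<open>inv \<phi>\<close> becomes an identity about \<open>\<phi>\<close>.\<close>
  have i: "inv \<phi> x = y" if "x = \<phi> y" for x y using that b by (simp add: bij_is_inj)
  show ?thesis
    unfolding antiisomorphism_def
    by (intro conjI allI i bij_imp_bij_inv[OF b]) (simp_all add: h surj_f_inv_f[OF bij_is_surj[OF b]])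
qed

lemma transpose_map_image_GL2:
  fixes \<phi> :: "'a::ring_1 \<Rightarrow> 'b::ring_1"
  assumes "antiisomorphism \<phi>"
  shows "transpose_map \<phi> ` GL2 = (GL2 :: ('b ^ 2 ^ 2) set)"
proof (intro equalityI subsetI)
  fix N :: "'b ^ 2 ^ 2" assume "N \<in> GL2"
  then have "transpose_map (inv \<phi>) N \<in> GL2"
    by (rule transpose_map_GL2[OF antiisomorphism_inv[OF assms]])
  \<comment> \<open>The two index swaps cancel, and so do \<open>\<phi>\<close> and its
    inverse.\<close>
  moreover have "transpose_map \<phi> (transpose_map (inv \<phi>) N) = N"
    using assms
    by (simp add: transpose_map_def vec_eq_iff antiisomorphism_def bij_is_surj surj_f_inv_f)
  ultimately show "N \<in> transpose_map \<phi> ` GL2" by (metis imageI)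
qed (auto intro: transpose_map_GL2[OF assms])

section \<open>The hat map on points of the dual line\<close>

lemma vec_map_act:
  assumes "antiisomorphism \<phi>"
  shows "vec_map \<phi> ` (\<lambda>x. M *v x) ` q = (\<lambda>x. x v* transpose_map \<phi> M) ` vec_map \<phi> ` q"
  by (simp add: image_image vec_map_mult[OF assms])

text \<open>This removes the definite description, leaving an elementwise image that is easy to
  handle. Off the dual projective line there are no admissible representatives, so the description
  specifies no value there.\<close>

lemma hat_map_eq_image:
  assumes "antiisomorphism \<phi>" "q \<in> dual_proj_line"
  shows "hat_map \<phi> q = vec_map \<phi> ` q"
proof -
  obtain M where M: "M \<in> GL2" "q = (\<lambda>x. M *v x) ` right_span (vector [1, 0])"
    using assms(2) by (auto simp: dual_proj_line_def)
  \<comment> \<open>The matrix sends the base column to its own first column, which is thus an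
    admissible representative of \<open>q\<close>.\<close>
  have *: "M *v (\<chi> i. vector [1, 0] $ i * r)
      = (\<chi> i. vector [M $ 1 $ 1, M $ 2 $ 1] $ i * r)" for r
    by (simp add: vec_eq_iff forall_2 matrix_vector_mult_def sum_2)
  have q: "q = right_span (vector [M $ 1 $ 1, M $ 2 $ 1])"
    by (simp add: M(2) right_span_def full_SetCompr_eq image_image *)
  have "vector [M $ 1 $ 1, M $ 2 $ 1] = column 1 M"
    by (simp add: vec_eq_iff forall_2 column_def)
  from hat_map_eq[OF assms(1) M(1) this] show ?thesis
    by (simp only: q vec_map_right_span[OF assms(1)])
qed

text \<open>Both lines are orbits of a base point, and the base points correspond; reindexing along
  \<open>transpose_map \<phi>\<close>, which is onto \<open>GL2\<close>, matches the orbits.\<close>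

lemma vec_map_dual_proj_line:
  assumes "antiisomorphism \<phi>"
  shows "(`) (vec_map \<phi>) ` dual_proj_line = proj_line"
proof -
  have "\<phi> 1 = 1" "\<phi> 0 = 0"
    using assms antiisomorphism_zero by (auto simp: antiisomorphism_def)
  then have "(`) (vec_map \<phi>) ` dual_proj_line
      = (\<lambda>M. (\<lambda>x. x v* M) ` left_span (vector [1, 0])) ` transpose_map \<phi> ` GL2"
    by (simp add: dual_proj_line_def Setcompr_eq_image image_image[of "(`) (vec_map \<phi>)"]
        image_image[of _ "transpose_map \<phi>"] vec_map_act[OF assms] vec_map_right_span[OF assms])
  then show ?thesis
    by (simp add: transpose_map_image_GL2[OF assms] proj_line_def Setcompr_eq_image)
qed

section \<open>Chains and conjugation by the unit\<close>

text \<open>On rows this is multiplication by \<open>u\<close> from the right; as \<open>u\<close>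
  need not be central, it can move points.\<close>

definition scalar_matrix :: "'a::ring_1 \<Rightarrow> 'a ^ 2 ^ 2" where
  "scalar_matrix u = vector [vector [u, 0], vector [0, u]]"

lemma scalar_matrix_mult: "scalar_matrix u ** scalar_matrix v = scalar_matrix (u * v)"
  by (simp add: scalar_matrix_def vec_eq_iff forall_2 matrix_matrix_mult_def sum_2)

lemma scalar_matrix_one: "scalar_matrix 1 = mat 1"
  by (simp add: scalar_matrix_def vec_eq_iff forall_2 mat_def)

text \<open>The unit \<open>v\<close> on the left is absorbed by the left span; the factor
  \<open>u\<close> on the right remains as a matrix action.\<close>

lemma left_span_conjugate:
  assumes "(u :: 'a::ring_1) * v = 1" "v * u = 1"
  shows "left_span (vector [v * k * u, v * l * u])
    = (\<lambda>x. x v* scalar_matrix u) ` left_span (vector [k, l])"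
proof -
  have *: "(r *s vector [k, l]) v* scalar_matrix u = r *s vector [k * u, l * u]" for r
    by (simp add: scalar_matrix_def vec_eq_iff forall_2 vector_matrix_mult_def
        vector_scalar_mult_def sum_2 mult.assoc)
  have "left_span (vector [v * k * u, v * l * u]) = left_span (vector [k * u, l * u])"
    using left_span_unit[OF assms(2,1), of "k * u" "l * u"] by (simp add: mult.assoc)
  also have "\<dots> = (\<lambda>x. x v* scalar_matrix u) ` left_span (vector [k, l])"
    by (simp add: left_span_def full_SetCompr_eq image_image *)
  finally show ?thesis .
qed

lemma standard_chain_image:
  "standard_chain K = (\<lambda>(k, l). left_span (vector [k, l])) ` (K \<times> K - {(0, 0)})"
  by (auto simp: standard_chain_def image_iff)

lemma vec_map_dual_standard_chain:
  assumes "antiisomorphism \<phi>"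
  shows "(`) (vec_map \<phi>) ` dual_standard_chain K = standard_chain (\<phi> ` K)"
proof -
  have "inj \<phi>" using assms by (simp add: antiisomorphism_def bij_is_inj)
  then have z: "\<phi> x = 0 \<longleftrightarrow> x = 0" for x
    using inj_eq[of \<phi> x 0] by (simp add: antiisomorphism_zero[OF assms])
  show ?thesis
  proof (intro equalityI subsetI)
    fix p assume "p \<in> (`) (vec_map \<phi>) ` dual_standard_chain K"
    then obtain k l where kl: "k \<in> K" "l \<in> K" "(k, l) \<noteq> (0, 0)"
      and p: "p = left_span (vector [\<phi> k, \<phi> l])"
      by (auto simp: dual_standard_chain_def vec_map_right_span[OF assms])
    have "(\<phi> k, \<phi> l) \<noteq> (0, 0)" using kl(3) by (simp add: z)
    then show "p \<in> standard_chain (\<phi> ` K)"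
      unfolding standard_chain_def p using kl(1,2) by blast
  next
    fix p assume "p \<in> standard_chain (\<phi> ` K)"
    then obtain k l where kl: "k \<in> K" "l \<in> K" "(k, l) \<noteq> (0, 0)"
      and p: "p = vec_map \<phi> ` right_span (vector [k, l])"
      by (auto simp: standard_chain_def vec_map_right_span[OF assms] z)
    have "right_span (vector [k, l]) \<in> dual_standard_chain K"
      unfolding dual_standard_chain_def using kl by blast
    then show "p \<in> (`) (vec_map \<phi>) ` dual_standard_chain K" unfolding p by (rule imageI)
  qed
qed

lemma standard_chain_conjugate:
  assumes uv: "(u :: 'a::ring_1) * v = 1" "v * u = 1"
  shows "standard_chain ((\<lambda>k. v * k * u) ` K)
    = (\<lambda>p. (\<lambda>x. x v* scalar_matrix u) ` p) ` standard_chain K"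
proof -
  \<comment> \<open>Conjugation can be undone, so only 0 goes to 0, and removing the pair (0, 0)
    commutes with conjugating both entries.\<close>
  have z: "v * k * u = 0 \<longleftrightarrow> k = 0" for k
  proof
    assume "v * k * u = 0"
    then have "u * (v * k * u) * v = 0" by simp
    moreover have "u * (v * k * u) * v = (u * v) * k * (u * v)" by (simp only: mult.assoc)
    ultimately show "k = 0" by (simp add: uv)
  qed simp
  have "(\<lambda>k. v * k * u) ` K \<times> (\<lambda>k. v * k * u) ` K - {(0, 0)}
      = (\<lambda>(k, l). (v * k * u, v * l * u)) ` (K \<times> K - {(0, 0)})"
    by (auto simp: z)
  then show ?thesis
    by (simp add: standard_chain_image image_image case_prod_unfold left_span_conjugate[OF uv])
qed

lemma left_mult_GL2_image:
  assumes "D \<in> GL2"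
  shows "(**) D ` GL2 = (GL2 :: ('a::ring_1 ^ 2 ^ 2) set)"
proof (intro equalityI subsetI)
  obtain E where E: "E \<in> GL2" "D ** E = mat 1" using assms by (rule GL2E)
  fix M :: "'a ^ 2 ^ 2" assume "M \<in> GL2"
  then have "E ** M \<in> GL2" by (rule GL2_mult[OF E(1)])
  moreover have "M = D ** (E ** M)" by (simp add: matrix_mul_assoc E)
  ultimately show "M \<in> (**) D ` GL2" by (rule rev_image_eqI)
qed (auto intro: GL2_mult[OF assms])

text \<open>The images of the dual chains form the orbit of a chain that is itself a
  \<open>GL2\<close> translate of \<open>standard_chain K'\<close>; a translate has the same
  orbit.\<close>

lemma vec_map_dual_chain_set:
  assumes \<phi>: "antiisomorphism \<phi>"
    and uv: "u * v = 1" "v * u = 1" and K: "\<phi> ` K = (\<lambda>k. v * k * u) ` K'"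
  shows "(\<lambda>C. (`) (vec_map \<phi>) ` C) ` dual_chain_set K = chain_set K'"
proof -
  have D: "scalar_matrix u \<in> GL2"
    by (rule GL2I[of _ "scalar_matrix v"]) (simp_all add: scalar_matrix_mult scalar_matrix_one uv)
  \<comment> \<open>Matrices act on rows from the right, so the scalar matrix, applied first, is the
    left factor.\<close>
  have act: "(`) (vec_map \<phi>) ` (\<lambda>p. (\<lambda>x. M *v x) ` p) ` dual_standard_chain K
      = (\<lambda>p. (\<lambda>x. x v* (scalar_matrix u ** transpose_map \<phi> M)) ` p) ` standard_chain K'" for M
  proof -
    have "(`) (vec_map \<phi>) ` (\<lambda>p. (\<lambda>x. M *v x) ` p) ` dual_standard_chain K
        = (\<lambda>p. (\<lambda>x. x v* transpose_map \<phi> M) ` p) ` (`) (vec_map \<phi>) ` dual_standard_chain K"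
      by (simp only: image_image[of "(`) (vec_map \<phi>)"] image_image[of _ "(`) (vec_map \<phi>)"]
          vec_map_act[OF \<phi>])
    also have "\<dots> = (\<lambda>p. (\<lambda>x. x v* transpose_map \<phi> M) ` p) `
        (\<lambda>p. (\<lambda>x. x v* scalar_matrix u) ` p) ` standard_chain K'"
      by (simp only: vec_map_dual_standard_chain[OF \<phi>] K standard_chain_conjugate[OF uv])
    finally show ?thesis by (simp add: image_image vector_matrix_assoc)
  qed
  have "(\<lambda>C. (`) (vec_map \<phi>) ` C) ` dual_chain_set K
      = (\<lambda>M. (\<lambda>p. (\<lambda>x. x v* M) ` p) ` standard_chain K')
        ` (**) (scalar_matrix u) ` transpose_map \<phi> ` GL2"
    unfolding dual_chain_set_def Setcompr_eq_image
    by (simp only: image_image[of _ _ GL2] act)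
  also have "\<dots> = chain_set K'"
    by (simp only: transpose_map_image_GL2[OF \<phi>] left_mult_GL2_image[OF D]
        chain_set_def Setcompr_eq_image)
  finally show ?thesis .
qed

section \<open>The chain isomorphism\<close>

lemma chain_isomorphism_comp:
  assumes "chain_isomorphism f \<Sigma> \<Sigma>'" "chain_isomorphism g \<Sigma>' \<Sigma>''"
  shows "chain_isomorphism (g \<circ> f) \<Sigma> \<Sigma>''"
  using assms bij_betw_trans[of "(`) f" _ _ "(`) g"]
  by (auto simp: chain_isomorphism_def comp_def image_image intro: bij_betw_trans[unfolded comp_def])

text \<open>\<open>hat_map\<close> is known to be an elementwise image only on points, so its action
  on a dual chain needs all members to be points. Via \<open>perp\<close> this follows from the same
  fact for ordinary chains.\<close>

lemma dual_chains_dual_proj_line: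
  assumes "skew_subfield K" "C \<in> dual_chain_set K"
  shows "C \<subseteq> dual_proj_line"
proof -
  have "(`) perp ` chain_set K = dual_chain_set K"
    using perp_chain_isomorphism[OF assms(1)]
    by (simp add: chain_isomorphism_def chain_geometry_def dual_chain_geometry_def bij_betw_def)
  then obtain B where "B \<in> chain_set K" "C = perp ` B" using assms(2) by (metis imageE)
  then show ?thesis
    using image_mono[OF chains_proj_line[OF assms(1)], of B perp] by (simp add: perp_proj_line)
qed

lemma hat_map_chain_isomorphism:
  assumes K: "skew_subfield K" and \<phi>: "antiisomorphism \<phi>"
    and uv: "u * v = 1" "v * u = 1" and conj: "\<phi> ` K = (\<lambda>k. v * k * u) ` K'"
  shows "chain_isomorphism (hat_map \<phi>) (dual_chain_geometry K) (chain_geometry K')"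
proof -
  have "inj \<phi>" using \<phi> by (simp add: antiisomorphism_def bij_is_inj)
  \<comment> \<open>Injectivity passes from vectors to sets of vectors, and further down to sets of
    points, so only the images of the points and of the chains have to be computed.\<close>
  then have inj: "inj ((`) (vec_map \<phi>))" by (simp add: inj_vec_map inj_on_image)
  have "bij_betw (hat_map \<phi>) dual_proj_line proj_line
      \<longleftrightarrow> bij_betw ((`) (vec_map \<phi>)) dual_proj_line proj_line"
    by (rule bij_betw_cong) (rule hat_map_eq_image[OF \<phi>])
  moreover have "bij_betw ((`) (hat_map \<phi>)) (dual_chain_set K) (chain_set K')
      \<longleftrightarrow> bij_betw ((`) ((`) (vec_map \<phi>))) (dual_chain_set K) (chain_set K')"
    by (intro bij_betw_cong image_cong refl hat_map_eq_image[OF \<phi>])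
      (use dual_chains_dual_proj_line[OF K] in blast)
  moreover have "bij_betw ((`) (vec_map \<phi>)) dual_proj_line proj_line"
    using inj by (auto simp: bij_betw_def vec_map_dual_proj_line[OF \<phi>] intro: inj_on_subset)
  moreover have "bij_betw ((`) ((`) (vec_map \<phi>))) (dual_chain_set K) (chain_set K')"
    using inj_on_subset[OF inj_on_image[of "(`) (vec_map \<phi>)" UNIV]] inj
    by (auto simp: bij_betw_def vec_map_dual_chain_set[OF \<phi> uv conj] inj_image_eq_iff inj_on_def)
  ultimately show ?thesis
    by (simp add: chain_isomorphism_def dual_chain_geometry_def chain_geometry_def)
qed

theorem theorem5p2:
  fixes K :: "'a::ring_1 set" and K' :: "'b::ring_1 set"
    and \<phi> :: "'a \<Rightarrow> 'b" and u' u'_inv :: 'b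
  assumes "skew_subfield K" and "K \<noteq> UNIV"
    and "skew_subfield K'" and "K' \<noteq> UNIV"
    and "antiisomorphism \<phi>"
    and "u' * u'_inv = 1" and "u'_inv * u' = 1"
    and "\<phi> ` K = (\<lambda>k'. u'_inv * k' * u') ` K'"
  shows "chain_isomorphism (hat_map \<phi> \<circ> perp) (chain_geometry K) (chain_geometry K')"
  by (rule chain_isomorphism_comp[OF perp_chain_isomorphism[OF assms(1)]
        hat_map_chain_isomorphism[OF assms(1) assms(5-8)]])

end
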